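(* Fix a finite set of atoms $A$ and a freshness context $\nabla$ (the global parameters of the algorithm $\mathsf{VNAU}$ described in the context). Let $P;\,S;\,\Gamma;\,\sigma$ be an arbitrary state, with $P$ and $S$ finite. Then there are only finitely many possible $\mathsf{VNAU}$ rule applications $P;\,S;\,\Gamma;\,\sigma \Longrightarrow P_i;\,S_i;\,\Gamma_i;\,\sigma_i$, $1\le i\le n$, and for every $1\le i\le n$ we have $\mu(P;\,S;\,\Gamma;\,\sigma) > \mu(P_i;\,S_i;\,\Gamma_i;\,\sigma_i)$, where $\mu$ is the measure defined in the context and $>$ is the lexicographic ordering on $\mathbb{N}^5$.
   Context: Signature: four pairwise disjoint sets: a countably infinite set of atoms $\mathbf{A}=\{a,b,c,\dots\}$, a countable set of variadic function symbols $\{f,g,h,\dots\}$, a countably infinite set of individual variables $\{x,y,z,\dots\}$ and a countably infinite set of hedge variables $\{X,Y,Z,\dots\}$; $\chi$ denotes a variable of either kind. Permutations $\pi$ of atoms have finite support $\mathrm{supp}(\pi)=\{a\mid \pi(a)\neq a\}$ and are written as finite sequences of swappings $(a\,b)$; $\mathit{Id}$ is the identity. Terms are individual terms $t::= a \mid \pi\cdot x \mid a.t \mid f(\tilde s)$, and hedges $\tilde s ::= r_1,\dots,r_n$ ($n\ge 0$) with $r::=\pi\cdot X\mid t$. Hedges are flat (nested sequences are concatenated), a singleton hedge is identified with its element, $\varepsilon$ is the empty hedge, $|\tilde s|$ is the length, $\tilde s|_i$ the $i$-th element. $\pi\cdot x$, $\pi\cdot X$ are suspensions; $\chi$ abbreviates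 $\mathit{Id}\cdot\chi$. Permutations act on terms: $(a\,b)\cdot a=b$, $(a\,b)\cdot b=a$, $(a\,b)\cdot c=c$ for $c\notin\{a,b\}$, $(a\,b)\cdot(\pi\cdot\chi)=((a\,b)\pi)\cdot\chi$, $(a\,b)\cdot(c.t)=((a\,b)\cdot c).((a\,b)\cdot t)$, $(a\,b)\cdot f(\tilde s)=f((a\,b)\cdot\tilde s)$, componentwise on hedges, and a sequence of swappings acts from right to left. The head of an individual term or hedge suspension is $\mathrm{head}(a)=a$, $\mathrm{head}(\pi\cdot\chi)=\chi$, $\mathrm{head}(a.t)=\text{``.''}$, $\mathrm{head}(f(\tilde s))=f$. Substitutions are finite maps from variables to terms (individual variables to individual terms), identity elsewhere; $id$ is the empty substitution; application: $a\sigma=a$, $(\pi\cdot\chi)\sigma=\pi\cdot(\chi\sigma)$, $(a.t)\sigma=a.(t\sigma)$, $f(\tilde s)\sigma=f(\tilde s\sigma)$, componentwise on hedges. $\sigma\{\chi\mapsto u\}$ denotes the composition of $\sigma$ followed by $\{\chi\mapsto u\}$. A freshness context is a finite set of constraints $a\#\chi$. The judgement $\nabla\vdash a\# u$ is defined by: $\nabla\vdash a\#b$ if $a\ne b$; $\nabla\vdash a\#f(\tilde s)$ if $\nabla\vdash a\#\tilde s$; $\nabla\vdash a\#(r_1,\dots,r_n)$ if $\nabla\vdash a\#r_i$ for all $i$; $\nabla\vdash a\#a.t$; $\nabla\vdash a\#b.t$ if $a\neq b$ and $\nabla\vdash a\#t$; $\nabla\vdash a\#\pi\cdot\chi$ if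 $(\pi^{-1}\cdot a)\#\chi\in\nabla$. Applying a substitution to a freshness context, $\Gamma\{\chi\mapsto u\}$, means replacing $\Gamma$ by the smallest freshness context $\Gamma'$ such that $\Gamma'\vdash a\#\chi'\{\chi\mapsto u\}$ for all $a\#\chi'\in\Gamma$. The equivalence $\nabla\vdash u\approx u'$ (equality up to renaming of bound atoms) is given by: $a\approx a$; $f(\tilde s)\approx f(\tilde q)$ if $\tilde s\approx\tilde q$; hedges of equal length componentwise; $a.t\approx a.t'$ if $t\approx t'$; $a.t\approx b.t'$ if $t\approx (a\,b)\cdot t'$ and $\nabla\vdash a\#b.t'$; $\pi\cdot\chi\approx\pi'\cdot\chi$ if $a\#\chi\in\nabla$ for all $a$ with $\pi\cdot a\neq\pi'\cdot a$. $A$-based means all atoms occurring (including in supports of permutations) lie in $A$. The algorithm $\mathsf{VNAU}$ (global parameters: finite $A\subset\mathbf{A}$ and freshness context $\nabla$) works on states $P;\,S;\,\Gamma;\,\sigma$ where $P$ (problems) and $S$ (store) are sets of anti-unification problems (AUPs) $\chi\colon \ell\triangleq r$ ($\chi$ a variable, $\ell,r$ terms or hedges), $\Gamma$ a freshness context, $\sigma$ a substitution. "New" variables occur neither in the state nor in the parameters; $\dot\cup$ is disjoint union. Rules: (Tri-T) $\{X\colon a\triangleq a\}\dot\cup P;S;\Gamma;\sigma \Rightarrow P;S;\Gamma;\sigma\{X\mapsto a\}$. (Tri-H) $\{X\colon \varepsilon\triangleq\varepsilon\}\dot\cup P;S;\Gamma;\sigma\Rightarrow P;S;\Gamma;\sigma\{X\mapsto\varepsilon\}$.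 (Dec-T) $\{X\colon f(\tilde s)\triangleq f(\tilde q)\}\dot\cup P;S;\Gamma;\sigma\Rightarrow\{Y\colon\tilde s\triangleq\tilde q\}\cup P;S;\Gamma;\sigma\{X\mapsto f(Y)\}$, $Y$ a new hedge variable. (Dec-H) $\{X\colon \tilde s_1,\tilde s_2\triangleq\tilde q_1,\tilde q_2\}\dot\cup P;S;\Gamma;\sigma\Rightarrow\{Y_1\colon\tilde s_1\triangleq\tilde q_1, Y_2\colon\tilde s_2\triangleq\tilde q_2\}\cup P;S;\Gamma;\sigma\{X\mapsto Y_1,Y_2\}$, where $|\tilde s_1,\tilde q_1|=1$ or $|\tilde s_1|=|\tilde q_1|=1$, $|\tilde s_2,\tilde q_2|\ge 1$, and $Y_1,Y_2$ are new hedge variables. (Abs-T) $\{X\colon a.t_1\triangleq b.t_2\}\dot\cup P;S;\Gamma;\sigma\Rightarrow\{Y\colon (c\,a)\cdot t_1\triangleq (c\,b)\cdot t_2\}\cup P;S;\Gamma;\sigma\{X\mapsto c.Y\}$, where $c\in A$, $Y$ a new hedge variable, $\nabla\vdash c\#a.t_1$ and $\nabla\vdash c\#b.t_2$. (Sol-T) $\{X\colon r_1\triangleq r_2\}\dot\cup P;S;\Gamma;\sigma\Rightarrow P;\{X\colon r_1\triangleq r_2\}\cup S;\{a\#X\mid a\in A,\nabla\vdash a\#r_1,\nabla\vdash a\#r_2\}\cup\Gamma;\sigma$, where $r_1,r_2$ are suspensions or $\mathrm{head}(r_1)\ne\mathrm{head}(r_2)$. (Sol-H) $\{X\colon \tilde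 s\triangleq\tilde q\}\dot\cup P;S;\Gamma;\sigma\Rightarrow P;\{X\colon\tilde s\triangleq\tilde q\}\cup S;\{a\#X\mid a\in A,\nabla\vdash a\#\tilde s,\nabla\vdash a\#\tilde q\}\cup\Gamma;\sigma$, where $|\tilde s,\tilde q|=1$. (Mer) $P;\{\chi_1\colon\ell_1\triangleq r_1,\chi_2\colon\ell_2\triangleq r_2\}\dot\cup S;\Gamma;\sigma\Rightarrow P;\{\chi_1\colon\ell_1\triangleq r_1\}\cup S;\Gamma\{\chi_2\mapsto\pi\cdot\chi_1\};\sigma\{\chi_2\mapsto\pi\cdot\chi_1\}$, where $\pi$ is an $A$-based permutation with $\nabla\vdash\pi\cdot\ell_1\approx\ell_2$ and $\nabla\vdash\pi\cdot r_1\approx r_2$. (Nar-T) $P;\{X\colon t_1\triangleq t_2\}\dot\cup S;\Gamma;\sigma\Rightarrow P;\{x\colon t_1\triangleq t_2\}\cup S;\Gamma\{X\mapsto x\};\sigma\{X\mapsto x\}$ ($t_1,t_2$ individual terms, $x$ new individual variable). The measure $\mu(P;S;\Gamma;\sigma)\in\mathbb{N}^5$ has components: (1) the total number of function-symbol occurrences and abstraction occurrences in all AUPs of $P$; (2) $\sum_{X\colon\tilde s\triangleq\tilde q\in P}|\tilde s,\tilde q|^2$; (3) the number of AUPs in $P$; (4) the number of AUPs in $S$; (5) the total number of hedge-variable occurrences in all AUPs of $S$. Measures are compared lexicographically. *)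

theory Defs
  imports Main "HOL-Library.Countable" "HOL-Combinatorics.Perm"
begin

unbundle permutation_syntax

section \<open>Terms and hedges\<close>

datatype atom = Atom nat

text \<open>\<open>IV\<close>: individual variables; \<open>HV\<close>: hedge variables.\<close>

datatype var = IV nat | HV nat

fun is_hvar :: "var \<Rightarrow> bool" where
  "is_hvar (HV _) = True"
| "is_hvar (IV _) = False"

text \<open>
  A hedge is a flat list of elements, and a singleton hedge \<open>[t]\<close> stands for its element \<open>t\<close>.
  Finitely supported permutations of atoms are the type \<^typ>\<open>atom perm\<close>, so two sequences of
  swappings that denote the same permutation are the same object.

  The body of an abstraction is typed as a hedge because the substitutions computed by the
  algorithm bind variables to expressions such as \<open>c.Y\<close> with a hedge variable \<open>Y\<close>, which are
  not terms of the grammar, and \<open>(c.Y)\<sigma> = c.(Y\<sigma>)\<close> has to make sense even if \<open>Y\<sigma>\<close> is not a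
  singleton. The grammar itself is imposed by \<open>iterm\<close> and \<open>is_hedge\<close> below.
\<close>

datatype 'f elem =
    Atm atom
  | Susp "atom perm" var
  | Abs atom "'f elem list"
  | App 'f "'f elem list"

type_synonym 'f hedge = "'f elem list"

inductive iterm :: "'f elem \<Rightarrow> bool" and is_hedge :: "'f hedge \<Rightarrow> bool" where
  "iterm (Atm a)"
| "iterm (Susp \<pi> (IV x))"
| "iterm t \<Longrightarrow> iterm (Abs a [t])"
| "is_hedge s \<Longrightarrow> iterm (App f s)"
| "is_hedge []"
| "is_hedge s \<Longrightarrow> is_hedge (Susp \<pi> (HV X) # s)"
| "iterm t \<Longrightarrow> is_hedge s \<Longrightarrow> is_hedge (t # s)"

fun is_susp :: "'f elem \<Rightarrow> bool" where
  "is_susp (Susp _ _) = True"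
| "is_susp _ = False"

datatype 'f hsym = HdAtm atom | HdVar var | HdDot | HdFun 'f

fun head :: "'f elem \<Rightarrow> 'f hsym" where
  "head (Atm a) = HdAtm a"
| "head (Susp \<pi> \<chi>) = HdVar \<chi>"
| "head (Abs a s) = HdDot"
| "head (App f s) = HdFun f"

primrec act :: "atom perm \<Rightarrow> 'f elem \<Rightarrow> 'f elem" where
  "act \<pi> (Atm a) = Atm (\<pi> \<langle>$\<rangle> a)"
| "act \<pi> (Susp \<pi>' \<chi>) = Susp (\<pi> * \<pi>') \<chi>"
| "act \<pi> (Abs a s) = Abs (\<pi> \<langle>$\<rangle> a) (map (act \<pi>) s)"
| "act \<pi> (App f s) = App f (map (act \<pi>) s)"

abbreviation act_hedge :: "atom perm \<Rightarrow> 'f hedge \<Rightarrow> 'f hedge" where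
  "act_hedge \<pi> s \<equiv> map (act \<pi>) s"

section \<open>Substitutions\<close>

type_synonym 'f subst = "var \<Rightarrow> 'f hedge"

definition id_subst :: "'f subst" where
  "id_subst \<chi> = [Susp 1 \<chi>]"

text \<open>
  Individual variables are mapped to expressions other than hedge suspensions; as explained above,
  abstraction bodies in the range are not restricted.
\<close>

definition is_subst :: "'f subst \<Rightarrow> bool" where
  "is_subst \<sigma> \<longleftrightarrow> finite {\<chi>. \<sigma> \<chi> \<noteq> id_subst \<chi>} \<and>
     (\<forall>x. \<exists>t. \<sigma> (IV x) = [t] \<and> (\<forall>\<pi> X. t \<noteq> Susp \<pi> (HV X)))"

primrec subst :: "'f subst \<Rightarrow> 'f elem \<Rightarrow> 'f hedge" where
  "subst \<sigma> (Atm a) = [Atm a]"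
| "subst \<sigma> (Susp \<pi> \<chi>) = act_hedge \<pi> (\<sigma> \<chi>)"
| "subst \<sigma> (Abs a s) = [Abs a (concat (map (subst \<sigma>) s))]"
| "subst \<sigma> (App f s) = [App f (concat (map (subst \<sigma>) s))]"

definition subst_hedge :: "'f subst \<Rightarrow> 'f hedge \<Rightarrow> 'f hedge" where
  "subst_hedge \<sigma> s = concat (map (subst \<sigma>) s)"

definition single :: "var \<Rightarrow> 'f hedge \<Rightarrow> 'f subst" where
  "single \<chi> u = id_subst(\<chi> := u)"

definition comp_subst :: "'f subst \<Rightarrow> 'f subst \<Rightarrow> 'f subst" where
  "comp_subst \<sigma> \<tau> = (\<lambda>\<chi>. subst_hedge \<tau> (\<sigma> \<chi>))"

section \<open>Freshness and equivalence\<close>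

type_synonym fctx = "(atom \<times> var) set"

inductive fresh :: "fctx \<Rightarrow> atom \<Rightarrow> 'f elem \<Rightarrow> bool"
  and fresh_hedge :: "fctx \<Rightarrow> atom \<Rightarrow> 'f hedge \<Rightarrow> bool" for N :: fctx where
  "a \<noteq> b \<Longrightarrow> fresh N a (Atm b)"
| "fresh_hedge N a s \<Longrightarrow> fresh N a (App f s)"
| "(\<forall>r\<in>set s. fresh N a r) \<Longrightarrow> fresh_hedge N a s"
| "fresh N a (Abs a s)"
| "a \<noteq> b \<Longrightarrow> fresh_hedge N a s \<Longrightarrow> fresh N a (Abs b s)"
| "(inverse \<pi> \<langle>$\<rangle> a, \<chi>) \<in> N \<Longrightarrow> fresh N a (Susp \<pi> \<chi>)"

inductive aeq :: "fctx \<Rightarrow> 'f elem \<Rightarrow> 'f elem \<Rightarrow> bool"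
  and aeq_hedge :: "fctx \<Rightarrow> 'f hedge \<Rightarrow> 'f hedge \<Rightarrow> bool" for N :: fctx where
  "aeq N (Atm a) (Atm a)"
| "aeq_hedge N s q \<Longrightarrow> aeq N (App f s) (App f q)"
| "list_all2 (aeq N) s q \<Longrightarrow> aeq_hedge N s q"
| "aeq_hedge N s s' \<Longrightarrow> aeq N (Abs a s) (Abs a s')"
| "aeq_hedge N s (act_hedge \<langle>a \<leftrightarrow> b\<rangle> s') \<Longrightarrow> fresh N a (Abs b s') \<Longrightarrow> aeq N (Abs a s) (Abs b s')"
| "(\<forall>a. \<pi> \<langle>$\<rangle> a \<noteq> \<pi>' \<langle>$\<rangle> a \<longrightarrow> (a, \<chi>) \<in> N) \<Longrightarrow> aeq N (Susp \<pi> \<chi>) (Susp \<pi>' \<chi>)"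

text \<open>
  The smallest context need not exist in general (take \<open>a#\<chi>\<close> and \<open>\<chi> \<mapsto> a\<close>). It does for
  \<open>{\<chi> \<mapsto> \<pi>\<cdot>\<chi>'}\<close>, the only kind of substitution that the algorithm applies to a context; see
  lemma \<open>subst_fctx_single\<close>.
\<close>

definition subst_fctx :: "'f subst \<Rightarrow> fctx \<Rightarrow> fctx" where
  "subst_fctx \<tau> \<Gamma> = (LEAST \<Gamma>'. finite \<Gamma>' \<and> (\<forall>(a, \<chi>)\<in>\<Gamma>. fresh_hedge \<Gamma>' a (subst \<tau> (Susp 1 \<chi>))))"

lemma fresh_hedge_Susp: "fresh_hedge N a [Susp \<pi> \<chi>] \<longleftrightarrow> (inverse \<pi> \<langle>$\<rangle> a, \<chi>) \<in> N"
  by (auto simp: fresh_hedge.simps fresh.simps[of N a "Susp \<pi> \<chi>"])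

lemma subst_fctx_single:
  assumes "finite \<Gamma>"
  shows "subst_fctx (single \<chi> [Susp \<pi> \<chi>']) \<Gamma> =
    (\<lambda>(a, \<chi>''). if \<chi>'' = \<chi> then (inverse \<pi> \<langle>$\<rangle> a, \<chi>') else (a, \<chi>'')) ` \<Gamma>"
  unfolding subst_fctx_def
proof (rule Least_equality)
  have [simp]: "inverse (1 :: atom perm) = 1"
    by (rule perm_eqI) (metis inverse_swap swap_1)
  let ?G = "(\<lambda>(a, \<chi>''). if \<chi>'' = \<chi> then (inverse \<pi> \<langle>$\<rangle> a, \<chi>') else (a, \<chi>'')) ` \<Gamma>"
  have iff: "fresh_hedge \<Gamma>' a (subst (single \<chi> [Susp \<pi> \<chi>']) (Susp 1 \<chi>'')) \<longleftrightarrow>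
      (if \<chi>'' = \<chi> then (inverse \<pi> \<langle>$\<rangle> a, \<chi>') else (a, \<chi>'')) \<in> \<Gamma>'" for \<Gamma>' a \<chi>''
    by (simp add: single_def id_subst_def fresh_hedge_Susp)
  show "finite ?G \<and> (\<forall>(a, \<chi>'')\<in>\<Gamma>.
      fresh_hedge ?G a (subst (single \<chi> [Susp \<pi> \<chi>']) (Susp 1 \<chi>'')))"
    unfolding iff using assms by force
  show "?G \<le> \<Gamma>'" if "finite \<Gamma>' \<and> (\<forall>(a, \<chi>'')\<in>\<Gamma>.
      fresh_hedge \<Gamma>' a (subst (single \<chi> [Susp \<pi> \<chi>']) (Susp 1 \<chi>'')))" for \<Gamma>'
    using that unfolding iff by auto
qed

section \<open>States\<close>

datatype 'f aup = AUP var (lhs: "'f hedge") (rhs: "'f hedge")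

type_synonym 'f state = "'f aup set \<times> 'f aup set \<times> fctx \<times> 'f subst"

fun is_state :: "'f state \<Rightarrow> bool" where
  "is_state (P, S, \<Gamma>, \<sigma>) \<longleftrightarrow>
     (\<forall>p\<in>P \<union> S. is_hedge (lhs p) \<and> is_hedge (rhs p)) \<and> finite \<Gamma> \<and> is_subst \<sigma>"

primrec vars :: "'f elem \<Rightarrow> var set" where
  "vars (Atm a) = {}"
| "vars (Susp \<pi> \<chi>) = {\<chi>}"
| "vars (Abs a s) = \<Union> (set (map vars s))"
| "vars (App f s) = \<Union> (set (map vars s))"

definition vars_hedge :: "'f hedge \<Rightarrow> var set" where
  "vars_hedge s = (\<Union>r\<in>set s. vars r)"

fun vars_aup :: "'f aup \<Rightarrow> var set" where
  "vars_aup (AUP \<chi> l r) = {\<chi>} \<union> vars_hedge l \<union> vars_hedge r"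

definition vars_subst :: "'f subst \<Rightarrow> var set" where
  "vars_subst \<sigma> = (\<Union>\<chi>\<in>{\<chi>. \<sigma> \<chi> \<noteq> id_subst \<chi>}. {\<chi>} \<union> vars_hedge (\<sigma> \<chi>))"

fun vars_state :: "'f state \<Rightarrow> var set" where
  "vars_state (P, S, \<Gamma>, \<sigma>) = (\<Union>p\<in>P \<union> S. vars_aup p) \<union> snd ` \<Gamma> \<union> vars_subst \<sigma>"

section \<open>The algorithm\<close>

text \<open>
  A label records the rule and every choice made in applying it, apart from the names of the
  new variables.
\<close>

datatype 'f rule_app =
    Tri_T "'f aup"
  | Tri_H "'f aup"
  | Dec_T "'f aup"
  | Dec_H var "'f hedge" "'f hedge" "'f hedge" "'f hedge"
  | Abs_T "'f aup" atom
  | Sol_T "'f aup"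
  | Sol_H "'f aup"
  | Mer "'f aup" "'f aup" "atom perm"
  | Nar_T "'f aup"

text \<open>
  In \<open>Dec_H\<close> the condition on \<open>s2, q2\<close> belongs to both alternatives. In \<open>Mer\<close> the two AUPs are
  distinct elements of the store, and \<open>{\<chi>2 \<mapsto> \<pi>\<cdot>\<chi>1}\<close> must respect the sorts of variables.
\<close>

inductive vnau :: "atom set \<Rightarrow> fctx \<Rightarrow> 'f rule_app \<Rightarrow> 'f state \<Rightarrow> 'f state \<Rightarrow> bool"
  for A :: "atom set" and N :: fctx where
  Tri_T:
  "p = AUP (HV X) [Atm a] [Atm a] \<Longrightarrow> p \<notin> P \<Longrightarrow>
   vnau A N (Tri_T p)
     (insert p P, S, \<Gamma>, \<sigma>)
     (P, S, \<Gamma>, comp_subst \<sigma> (single (HV X) [Atm a]))"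
| Tri_H:
  "p = AUP (HV X) [] [] \<Longrightarrow> p \<notin> P \<Longrightarrow>
   vnau A N (Tri_H p)
     (insert p P, S, \<Gamma>, \<sigma>)
     (P, S, \<Gamma>, comp_subst \<sigma> (single (HV X) []))"
| Dec_T:
  "p = AUP (HV X) [App f s] [App f q] \<Longrightarrow> p \<notin> P \<Longrightarrow>
   HV Y \<notin> vars_state (insert p P, S, \<Gamma>, \<sigma>) \<union> snd ` N \<Longrightarrow>
   vnau A N (Dec_T p)
     (insert p P, S, \<Gamma>, \<sigma>)
     ({AUP (HV Y) s q} \<union> P, S, \<Gamma>, comp_subst \<sigma> (single (HV X) [App f [Susp 1 (HV Y)]]))"
| Dec_H:
  "p = AUP (HV X) (s1 @ s2) (q1 @ q2) \<Longrightarrow> p \<notin> P \<Longrightarrow>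
   length (s1 @ q1) = 1 \<or> (length s1 = 1 \<and> length q1 = 1) \<Longrightarrow> length (s2 @ q2) \<ge> 1 \<Longrightarrow>
   HV Y1 \<notin> vars_state (insert p P, S, \<Gamma>, \<sigma>) \<union> snd ` N \<Longrightarrow>
   HV Y2 \<notin> vars_state (insert p P, S, \<Gamma>, \<sigma>) \<union> snd ` N \<Longrightarrow> Y1 \<noteq> Y2 \<Longrightarrow>
   vnau A N (Dec_H (HV X) s1 s2 q1 q2)
     (insert p P, S, \<Gamma>, \<sigma>)
     ({AUP (HV Y1) s1 q1, AUP (HV Y2) s2 q2} \<union> P, S, \<Gamma>,
      comp_subst \<sigma> (single (HV X) [Susp 1 (HV Y1), Susp 1 (HV Y2)]))"
| Abs_T:
  "p = AUP (HV X) [Abs a [t1]] [Abs b [t2]] \<Longrightarrow> p \<notin> P \<Longrightarrow>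
   c \<in> A \<Longrightarrow> fresh N c (Abs a [t1]) \<Longrightarrow> fresh N c (Abs b [t2]) \<Longrightarrow>
   HV Y \<notin> vars_state (insert p P, S, \<Gamma>, \<sigma>) \<union> snd ` N \<Longrightarrow>
   vnau A N (Abs_T p c)
     (insert p P, S, \<Gamma>, \<sigma>)
     ({AUP (HV Y) [act \<langle>c \<leftrightarrow> a\<rangle> t1] [act \<langle>c \<leftrightarrow> b\<rangle> t2]} \<union> P, S, \<Gamma>,
      comp_subst \<sigma> (single (HV X) [Abs c [Susp 1 (HV Y)]]))"
| Sol_T:
  "p = AUP (HV X) [r1] [r2] \<Longrightarrow> p \<notin> P \<Longrightarrow>
   (is_susp r1 \<and> is_susp r2) \<or> head r1 \<noteq> head r2 \<Longrightarrow>
   vnau A N (Sol_T p)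
     (insert p P, S, \<Gamma>, \<sigma>)
     (P, {p} \<union> S, {(a, HV X) | a. a \<in> A \<and> fresh N a r1 \<and> fresh N a r2} \<union> \<Gamma>, \<sigma>)"
| Sol_H:
  "p = AUP (HV X) s q \<Longrightarrow> p \<notin> P \<Longrightarrow> length (s @ q) = 1 \<Longrightarrow>
   vnau A N (Sol_H p)
     (insert p P, S, \<Gamma>, \<sigma>)
     (P, {p} \<union> S, {(a, HV X) | a. a \<in> A \<and> fresh_hedge N a s \<and> fresh_hedge N a q} \<union> \<Gamma>, \<sigma>)"
| Mer:
  "p1 = AUP \<chi>1 l1 r1 \<Longrightarrow> p2 = AUP \<chi>2 l2 r2 \<Longrightarrow> p1 \<noteq> p2 \<Longrightarrow> p1 \<notin> S \<Longrightarrow> p2 \<notin> S \<Longrightarrow>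
   (is_hvar \<chi>1 \<longrightarrow> is_hvar \<chi>2) \<Longrightarrow> affected \<pi> \<subseteq> A \<Longrightarrow>
   aeq_hedge N (act_hedge \<pi> l1) l2 \<Longrightarrow> aeq_hedge N (act_hedge \<pi> r1) r2 \<Longrightarrow>
   vnau A N (Mer p1 p2 \<pi>)
     (P, {p1, p2} \<union> S, \<Gamma>, \<sigma>)
     (P, {p1} \<union> S, subst_fctx (single \<chi>2 [Susp \<pi> \<chi>1] :: 'f subst) \<Gamma>,
      comp_subst \<sigma> (single \<chi>2 [Susp \<pi> \<chi>1]))"
| Nar_T:
  "p = AUP (HV X) [t1] [t2] \<Longrightarrow> p \<notin> S \<Longrightarrow> iterm t1 \<Longrightarrow> iterm t2 \<Longrightarrow>
   IV x \<notin> vars_state (P, insert p S, \<Gamma>, \<sigma>) \<union> snd ` N \<Longrightarrow>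
   vnau A N (Nar_T p)
     (P, insert p S, \<Gamma>, \<sigma>)
     (P, {AUP (IV x) [t1] [t2]} \<union> S, subst_fctx (single (HV X) [Susp 1 (IV x)] :: 'f subst) \<Gamma>,
      comp_subst \<sigma> (single (HV X) [Susp 1 (IV x)]))"

section \<open>Renaming of variables\<close>

primrec rename :: "var perm \<Rightarrow> 'f elem \<Rightarrow> 'f elem" where
  "rename \<rho> (Atm a) = Atm a"
| "rename \<rho> (Susp \<pi> \<chi>) = Susp \<pi> (\<rho> \<langle>$\<rangle> \<chi>)"
| "rename \<rho> (Abs a s) = Abs a (map (rename \<rho>) s)"
| "rename \<rho> (App f s) = App f (map (rename \<rho>) s)"

fun rename_aup :: "var perm \<Rightarrow> 'f aup \<Rightarrow> 'f aup" where
  "rename_aup \<rho> (AUP \<chi> l r) = AUP (\<rho> \<langle>$\<rangle> \<chi>) (map (rename \<rho>) l) (map (rename \<rho>) r)"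

fun rename_state :: "var perm \<Rightarrow> 'f state \<Rightarrow> 'f state" where
  "rename_state \<rho> (P, S, \<Gamma>, \<sigma>) =
     (rename_aup \<rho> ` P, rename_aup \<rho> ` S, map_prod id (\<lambda>\<chi>. \<rho> \<langle>$\<rangle> \<chi>) ` \<Gamma>,
      (\<lambda>\<chi>. map (rename \<rho>) (\<sigma> (inverse \<rho> \<langle>$\<rangle> \<chi>))))"

text \<open>Equality of states up to the names of the variables outside \<open>V\<close>.\<close>

definition variant :: "var set \<Rightarrow> 'f state \<Rightarrow> 'f state \<Rightarrow> bool" where
  "variant V st st' \<longleftrightarrow>
     (\<exists>\<rho>. (\<forall>\<chi>. is_hvar (\<rho> \<langle>$\<rangle> \<chi>) = is_hvar \<chi>) \<and> (\<forall>\<chi>\<in>V. \<rho> \<langle>$\<rangle> \<chi> = \<chi>) \<and> st' = rename_state \<rho> st)"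

section \<open>The measure\<close>

primrec symbols :: "'f elem \<Rightarrow> nat" where
  "symbols (Atm a) = 0"
| "symbols (Susp \<pi> \<chi>) = 0"
| "symbols (Abs a s) = Suc (sum_list (map symbols s))"
| "symbols (App f s) = Suc (sum_list (map symbols s))"

fun symbols_aup :: "'f aup \<Rightarrow> nat" where
  "symbols_aup (AUP \<chi> l r) = sum_list (map symbols l) + sum_list (map symbols r)"

fun sq_length_aup :: "'f aup \<Rightarrow> nat" where
  "sq_length_aup (AUP \<chi> l r) = (if is_hvar \<chi> then (length (l @ r))\<^sup>2 else 0)"

primrec hvars :: "'f elem \<Rightarrow> nat" where
  "hvars (Atm a) = 0"
| "hvars (Susp \<pi> \<chi>) = of_bool (is_hvar \<chi>)"
| "hvars (Abs a s) = sum_list (map hvars s)"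
| "hvars (App f s) = sum_list (map hvars s)"

text \<open>The variable that labels an AUP counts as an occurrence.\<close>

fun hvars_aup :: "'f aup \<Rightarrow> nat" where
  "hvars_aup (AUP \<chi> l r) =
     of_bool (is_hvar \<chi>) + sum_list (map hvars l) + sum_list (map hvars r)"

fun \<mu> :: "'f state \<Rightarrow> nat \<times> nat \<times> nat \<times> nat \<times> nat" where
  "\<mu> (P, S, \<Gamma>, \<sigma>) =
     (\<Sum>p\<in>P. symbols_aup p, \<Sum>p\<in>P. sq_length_aup p, card P, card S, \<Sum>p\<in>S. hvars_aup p)"

definition lex5 :: "((nat \<times> nat \<times> nat \<times> nat \<times> nat) \<times> (nat \<times> nat \<times> nat \<times> nat \<times> nat)) set" where
  "lex5 = less_than <*lex*> less_than <*lex*> less_than <*lex*> less_than <*lex*> less_than"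

end

theory Submission
  imports Defs "HOL-Combinatorics.Permutations"
begin

text \<open>
  A label ranges over a finite set, because every choice it records is an AUP of the state, a split
  of a hedge, an atom of \<open>A\<close>, or a permutation whose support lies in \<open>A\<close>. Two successors under the
  same label differ only in the names of at most two new variables, and swapping these names is a
  renaming that fixes all old variables. So one successor per label represents them all.
  Freshness also guarantees that an AUP added under a new variable does not collapse with an
  existing one, which makes the sums and cardinalities in \<open>\<mu>\<close> behave additively.
\<close>

section \<open>Finitely many labels\<close>

text \<open>Function application embeds these permutations injectively into the functions that
  permute \<open>A\<close>. This bounds the choices in \<open>Mer\<close>, the only rule that picks
  a permutation.\<close>

lemma finite_perms_affected_subset:
  assumes "finite A"
  shows "finite {\<pi>. affected \<pi> \<subseteq> A}"
proof (rule finite_imageD)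
  have "(\<langle>$\<rangle>) ` {\<pi>. affected \<pi> \<subseteq> A} \<subseteq> {p. p permutes A}"
    by (auto simp: permutes_def in_affected apply_inj) (metis bij_apply bij_pointE)
  then show "finite ((\<langle>$\<rangle>) ` {\<pi>. affected \<pi> \<subseteq> A})"
    using finite_permutations[OF assms] finite_subset by blast
  show "inj_on (\<langle>$\<rangle>) {\<pi>. affected \<pi> \<subseteq> A}"
    by (auto intro!: inj_onI perm_eqI)
qed

text \<open>Indexing the splits by cut positions makes finiteness immediate. All pairs of positions
  are taken, since a superset of the \<open>Dec_H\<close> labels is enough.\<close>

primrec split_labels :: "'f aup \<Rightarrow> 'f rule_app set" where
  "split_labels (AUP \<chi> l r) =
     (\<lambda>(i, j). Dec_H \<chi> (take i l) (drop i l) (take j r) (drop j r)) `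
       ({..length l} \<times> {..length r})"

lemma Dec_H_in_split_labels: "Dec_H \<chi> s1 s2 q1 q2 \<in> split_labels (AUP \<chi> (s1 @ s2) (q1 @ q2))"
  by (auto intro!: image_eqI[of _ _ "(length s1, length q1)"])

lemma finite_labels:
  assumes "finite A" "finite P" "finite S"
  shows "finite {k. \<exists>st. vnau A N k (P, S, \<Gamma>, \<sigma>) st}"
proof -
  let ?K = "Tri_T ` P \<union> Tri_H ` P \<union> Dec_T ` P \<union> Sol_T ` P \<union> Sol_H ` P \<union> Nar_T ` S \<union>
    (\<Union>p\<in>P. split_labels p) \<union> (\<Union>p\<in>P. Abs_T p ` A) \<union>
    (\<Union>p\<in>S. \<Union>q\<in>S. Mer p q ` {\<pi>. affected \<pi> \<subseteq> A})"
  have "finite (split_labels p)" for p :: "'a aup"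
    by (cases p) simp
  then have finite: "finite ?K"
    using assms finite_perms_affected_subset[OF assms(1)] by auto
  have "k \<in> ?K" if "vnau A N k (P, S, \<Gamma>, \<sigma>) st" for k st
    using that
  proof cases
    case (Dec_H p X s1 s2 q1 q2)
    \<comment> \<open>A \<open>Dec_H\<close> label stores four pieces instead of the AUP, so
      \<open>p\<close> has to be recognised as built from their concatenations.\<close>
    then have "k \<in> split_labels p" "p \<in> P"
      by (simp_all only: Dec_H_in_split_labels) simp
    then show ?thesis by blast
  qed auto
  then have "{k. \<exists>st. vnau A N k (P, S, \<Gamma>, \<sigma>) st} \<subseteq> ?K"
    by (intro subsetI, elim CollectE exE)
  then show ?thesis
    using finite by (rule finite_subset)
qed

section \<open>Renaming of variables\<close>

text \<open>The conjugation action on substitutions, written as in the last component of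
  \<open>rename_state\<close>.\<close>

abbreviation rename_subst :: "var perm \<Rightarrow> 'f subst \<Rightarrow> 'f subst" where
  "rename_subst \<rho> \<sigma> \<equiv> \<lambda>\<chi>. map (rename \<rho>) (\<sigma> (inverse \<rho> \<langle>$\<rangle> \<chi>))"

lemma rename_fixed: "(\<forall>\<chi>\<in>vars t. \<rho> \<langle>$\<rangle> \<chi> = \<chi>) \<Longrightarrow> rename \<rho> t = t"
  by (induction t) (auto intro!: map_idI)

lemma rename_hedge_fixed: "(\<forall>\<chi>\<in>vars_hedge s. \<rho> \<langle>$\<rangle> \<chi> = \<chi>) \<Longrightarrow> map (rename \<rho>) s = s"
  by (auto simp: vars_hedge_def intro!: map_idI rename_fixed)

lemma rename_aup_fixed: "(\<forall>\<chi>\<in>vars_aup p. \<rho> \<langle>$\<rangle> \<chi> = \<chi>) \<Longrightarrow> rename_aup \<rho> p = p"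
  by (cases p) (simp add: rename_hedge_fixed)

lemma rename_act: "rename \<rho> (act \<pi> t) = act \<pi> (rename \<rho> t)"
  by (induction t) auto

lemma rename_inverse_apply: "\<rho> \<langle>$\<rangle> (inverse \<rho> \<langle>$\<rangle> \<chi>) = \<chi>" "inverse \<rho> \<langle>$\<rangle> (\<rho> \<langle>$\<rangle> \<chi>) = \<chi>"
  by (simp_all add: apply_inverse surj_f_inv_f bij_is_surj bij_is_inj)

text \<open>At a suspension, the inverse inside \<open>rename_subst\<close> cancels the renaming of
  the suspended variable, and renaming commutes with the action of atom permutations.\<close>

lemma rename_subst_elem:
  "map (rename \<rho>) (subst \<sigma> t) = subst (rename_subst \<rho> \<sigma>) (rename \<rho> t)"
proof (induction t)
  case (Abs a s)
  \<comment> \<open>An equation between mapped lists can rewrite under \<open>concat\<close>;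
    \<open>map_eq_conv\<close> would turn it back into a pointwise statement.\<close>
  then have "map (\<lambda>t. map (rename \<rho>) (subst \<sigma> t)) s
      = map (\<lambda>t. subst (rename_subst \<rho> \<sigma>) (rename \<rho> t)) s"
    by simp
  then show ?case
    by (simp add: map_concat comp_def del: map_eq_conv)
next
  case (App f s)
  then have "map (\<lambda>t. map (rename \<rho>) (subst \<sigma> t)) s
      = map (\<lambda>t. subst (rename_subst \<rho> \<sigma>) (rename \<rho> t)) s"
    by simp
  then show ?case
    by (simp add: map_concat comp_def del: map_eq_conv)
qed (auto simp: rename_act rename_inverse_apply)

lemma rename_comp_subst:
  "rename_subst \<rho> (comp_subst \<sigma> \<tau>) = comp_subst (rename_subst \<rho> \<sigma>) (rename_subst \<rho> \<tau>)"
  by (auto simp: comp_subst_def subst_hedge_def map_concat comp_def rename_subst_elem)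

lemma rename_single:
  "rename_subst \<rho> (single \<chi> u) = single (\<rho> \<langle>$\<rangle> \<chi>) (map (rename \<rho>) u)"
  by (auto simp: single_def id_subst_def fun_eq_iff rename_inverse_apply)

text \<open>\<open>vars_subst\<close> covers the domain and the variables of the range. If the
  preimage of \<chi> is in the domain, it is fixed and equals \<chi>; otherwise \<chi> is outside
  the domain too, and both sides are the identity there.\<close>

lemma rename_subst_fixed:
  assumes "\<forall>\<chi>\<in>vars_subst \<sigma>. \<rho> \<langle>$\<rangle> \<chi> = \<chi>"
  shows "rename_subst \<rho> \<sigma> = \<sigma>"
proof
  fix \<chi>
  show "rename_subst \<rho> \<sigma> \<chi> = \<sigma> \<chi>"
  proof (cases "\<sigma> (inverse \<rho> \<langle>$\<rangle> \<chi>) = id_subst (inverse \<rho> \<langle>$\<rangle> \<chi>)")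
    case True
    have "\<sigma> \<chi> = id_subst \<chi>"
    proof (rule ccontr)
      assume *: "\<sigma> \<chi> \<noteq> id_subst \<chi>"
      then have "\<rho> \<langle>$\<rangle> \<chi> = \<chi>"
        using assms by (auto simp: vars_subst_def)
      then show False
        using * True by (metis rename_inverse_apply(2))
    qed
    then show ?thesis
      by (simp add: True id_subst_def rename_inverse_apply)
  next
    case False
    then have "inverse \<rho> \<langle>$\<rangle> \<chi> = \<chi>"
      using assms by (force simp: vars_subst_def rename_inverse_apply)
    then show ?thesis
      using False assms by (auto simp: vars_subst_def intro!: rename_hedge_fixed)
  qed
qed

text \<open>The form needed for successors: the old \<sigma> is untouched, so only the binding added
  by the rule gets renamed.\<close>

lemma rename_comp_subst_single:
  assumes "\<forall>\<chi>\<in>vars_subst \<sigma>. \<rho> \<langle>$\<rangle> \<chi> = \<chi>"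
  shows "rename_subst \<rho> (comp_subst \<sigma> (single \<chi> u)) =
    comp_subst \<sigma> (single (\<rho> \<langle>$\<rangle> \<chi>) (map (rename \<rho>) u))"
  by (simp only: rename_comp_subst rename_single rename_subst_fixed[OF assms])

lemma rename_aups_fixed:
  assumes "\<forall>\<chi>\<in>(\<Union>p\<in>P. vars_aup p). \<rho> \<langle>$\<rangle> \<chi> = \<chi>"
  shows "rename_aup \<rho> ` P = P"
proof -
  have "rename_aup \<rho> p = p" if "p \<in> P" for p
    using assms that by (intro rename_aup_fixed) blast
  then show ?thesis by force
qed

lemma rename_fctx_fixed:
  assumes "\<forall>\<chi>\<in>snd ` \<Gamma>. \<rho> \<langle>$\<rangle> \<chi> = \<chi>"
  shows "map_prod id (\<lambda>\<chi>. \<rho> \<langle>$\<rangle> \<chi>) ` \<Gamma> = \<Gamma>"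
proof -
  have "map_prod id (\<lambda>\<chi>. \<rho> \<langle>$\<rangle> \<chi>) x = x" if "x \<in> \<Gamma>" for x
    using assms that by (cases x) force
  then show ?thesis by force
qed

text \<open>Needed for \<open>Nar_T\<close>, where \<chi>' is the new variable. The explicit form of
  the context reduces the claim to single constraints: those on \<chi> move to \<chi>', all others
  stay.\<close>

lemma rename_subst_fctx_single:
  assumes "finite \<Gamma>" "\<forall>\<chi>\<in>snd ` \<Gamma>. \<rho> \<langle>$\<rangle> \<chi> = \<chi>" "\<rho> \<langle>$\<rangle> \<chi> = \<chi>"
  shows "map_prod id (\<lambda>\<chi>. \<rho> \<langle>$\<rangle> \<chi>) `
      subst_fctx (single \<chi> [Susp \<pi> \<chi>'] :: 'f subst) \<Gamma> =
    subst_fctx (single \<chi> [Susp \<pi> (\<rho> \<langle>$\<rangle> \<chi>')] :: 'f subst) \<Gamma>"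
  unfolding subst_fctx_single[OF assms(1)] image_image
  using assms(2,3) by (intro image_cong) force+

lemma variant_refl: "variant V st st"
proof -
  obtain P S \<Gamma> \<sigma> where st: "st = (P, S, \<Gamma>, \<sigma>)"
    by (cases st)
  have "rename_subst 1 \<sigma> = \<sigma>"
    by (rule rename_subst_fixed) simp
  then have "rename_state 1 st = st"
    by (simp add: st rename_aups_fixed prod.map_id0)
  then show ?thesis
    unfolding variant_def by (intro exI[of _ 1]) simp
qed

text \<open>A transposition works: it moves at most two variables, both outside \<open>V\<close>,
  and these have the same sort.\<close>

lemma renaming_one_exists:
  assumes "\<chi> \<notin> V" "\<chi>' \<notin> V" "is_hvar \<chi> = is_hvar \<chi>'"
  obtains \<rho> where "\<forall>\<chi>. is_hvar (\<rho> \<langle>$\<rangle> \<chi>) = is_hvar \<chi>" "\<forall>\<chi>\<in>V. \<rho> \<langle>$\<rangle> \<chi> = \<chi>" "\<rho> \<langle>$\<rangle> \<chi> = \<chi>'"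
proof -
  have "\<langle>\<chi> \<leftrightarrow> \<chi>'\<rangle> \<langle>$\<rangle> \<xi> = (if \<xi> = \<chi> then \<chi>' else if \<xi> = \<chi>' then \<chi> else \<xi>)" for \<xi>
    by simp
  then show thesis
    using assms by (intro that[of "\<langle>\<chi> \<leftrightarrow> \<chi>'\<rangle>"]) auto
qed

text \<open>The two pairs of names may overlap, for instance \<open>Y1' = Y2\<close>, so composing
  the two obvious transpositions can fail. The second renaming therefore starts from the image of
  \<open>HV Y2\<close> under the first and keeps \<open>HV Y1'\<close> fixed.\<close>

lemma renaming_two_exists:
  assumes "HV Y1 \<notin> V" "HV Y1' \<notin> V" "HV Y2 \<notin> V" "HV Y2' \<notin> V" "Y1 \<noteq> Y2" "Y1' \<noteq> Y2'"
  obtains \<rho> where "\<forall>\<chi>. is_hvar (\<rho> \<langle>$\<rangle> \<chi>) = is_hvar \<chi>" "\<forall>\<chi>\<in>V. \<rho> \<langle>$\<rangle> \<chi> = \<chi>"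
    "\<rho> \<langle>$\<rangle> (HV Y1) = HV Y1'" "\<rho> \<langle>$\<rangle> (HV Y2) = HV Y2'"
proof -
  obtain \<rho>1 where 1: "\<forall>\<chi>. is_hvar (\<rho>1 \<langle>$\<rangle> \<chi>) = is_hvar \<chi>" "\<forall>\<chi>\<in>V. \<rho>1 \<langle>$\<rangle> \<chi> = \<chi>"
    "\<rho>1 \<langle>$\<rangle> (HV Y1) = HV Y1'"
    using renaming_one_exists[of "HV Y1" V "HV Y1'"] assms by auto
  \<comment> \<open>Injectivity of \<rho>1 separates this image from \<open>HV Y1'\<close>, and also
    from \<open>V\<close>, which \<rho>1 fixes pointwise.\<close>
  have "\<rho>1 \<langle>$\<rangle> (HV Y2) \<notin> insert (HV Y1') V"
    using 1 assms by (metis insert_iff rename_inverse_apply(2) var.inject(2))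
  then obtain \<rho>2 where 2: "\<forall>\<chi>. is_hvar (\<rho>2 \<langle>$\<rangle> \<chi>) = is_hvar \<chi>"
    "\<forall>\<chi>\<in>insert (HV Y1') V. \<rho>2 \<langle>$\<rangle> \<chi> = \<chi>" "\<rho>2 \<langle>$\<rangle> (\<rho>1 \<langle>$\<rangle> (HV Y2)) = HV Y2'"
    using renaming_one_exists[of "\<rho>1 \<langle>$\<rangle> (HV Y2)" "insert (HV Y1') V" "HV Y2'"] assms 1 by auto
  show thesis
  proof (rule that[of "\<rho>2 * \<rho>1"])
    show "\<forall>\<chi>. is_hvar ((\<rho>2 * \<rho>1) \<langle>$\<rangle> \<chi>) = is_hvar \<chi>"
      using 1(1) 2(1) by (simp add: apply_times)
    show "\<forall>\<chi>\<in>V. (\<rho>2 * \<rho>1) \<langle>$\<rangle> \<chi> = \<chi>"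
      using 1(2) 2(2) by (simp add: apply_times)
    show "(\<rho>2 * \<rho>1) \<langle>$\<rangle> (HV Y1) = HV Y1'"
      using 1(3) 2(2) by (simp add: apply_times)
    show "(\<rho>2 * \<rho>1) \<langle>$\<rangle> (HV Y2) = HV Y2'"
      using 2(3) by (simp add: apply_times)
  qed
qed

section \<open>A label determines the successor up to renaming\<close>

inductive_cases vnau_labelE:
  "vnau A N (Tri_T p) st st'"
  "vnau A N (Tri_H p) st st'"
  "vnau A N (Dec_T p) st st'"
  "vnau A N (Dec_H \<chi> s1 s2 q1 q2) st st'"
  "vnau A N (Abs_T p c) st st'"
  "vnau A N (Sol_T p) st st'"
  "vnau A N (Sol_H p) st st'"
  "vnau A N (Mer p q \<pi>) st st'"
  "vnau A N (Nar_T p) st st'"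

lemma variantI:
  assumes "\<forall>\<chi>. is_hvar (\<rho> \<langle>$\<rangle> \<chi>) = is_hvar \<chi>" "\<forall>\<chi>\<in>V. \<rho> \<langle>$\<rangle> \<chi> = \<chi>" "st' = rename_state \<rho> st"
  shows "variant V st st'"
  using assms unfolding variant_def by blast

text \<open>Finiteness of the freshness context gives \<open>subst_fctx\<close> its explicit form,
  on which the renaming in the \<open>Nar_T\<close> case is computed.\<close>

lemma vnau_label_variant:
  assumes "vnau A N k st0 st" "vnau A N k st0 st'" "finite (fst (snd (snd st0)))"
  shows "variant (vars_state st0 \<union> snd ` N) st st'"
  using assms(1)
proof cases
  case (Tri_T p X a P S \<Gamma> \<sigma>)
  \<comment> \<open>No new variable is chosen. Since \<open>p\<close> is absent from the remaining
    problems, \<open>insert_ident\<close> recovers them from the whole set, and the successors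
    coincide.\<close>
  then have "st' = st"
    using assms(2) by (auto elim!: vnau_labelE dest: insert_ident)
  then show ?thesis by (simp add: variant_refl)
next
  case (Tri_H p X P S \<Gamma> \<sigma>)
  then have "st' = st"
    using assms(2) by (auto elim!: vnau_labelE dest: insert_ident)
  then show ?thesis by (simp add: variant_refl)
next
  case (Sol_T p X r1 r2 P S \<Gamma> \<sigma>)
  then have "st' = st"
    using assms(2) by (auto elim!: vnau_labelE dest: insert_ident)
  then show ?thesis by (simp add: variant_refl)
next
  case (Sol_H p X s q P S \<Gamma> \<sigma>)
  then have "st' = st"
    using assms(2) by (auto elim!: vnau_labelE dest: insert_ident)
  then show ?thesis by (simp add: variant_refl)
next
  case (Mer p1 \<chi>1 l1 r1 p2 \<chi>2 l2 r2 S \<pi> P \<Gamma> \<sigma>)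
  note outer = this
  \<comment> \<open>The counterpart of \<open>insert_ident\<close> for the two AUPs that
    \<open>Mer\<close> takes out of the store.\<close>
  have eq: "T = T'" if "{p1, p2} \<union> T = {p1, p2} \<union> T'" "p1 \<notin> T" "p2 \<notin> T" "p1 \<notin> T'" "p2 \<notin> T'"
    for T T' :: "'a aup set"
  proof -
    have "T = ({p1, p2} \<union> T) - {p1, p2}"
      using that by auto
    also have "\<dots> = T'"
      unfolding that(1) using that by auto
    finally show ?thesis .
  qed
  have "st' = st"
    using assms(2) unfolding Mer(1)
  proof cases
    case (Mer \<chi>1' l1' r1' \<chi>2' l2' r2' S' P' \<Gamma>' \<sigma>')
    then show ?thesis
      using outer eq[of S S'] by simp
  qed
  then show ?thesis by (simp add: variant_refl)
next
  case (Dec_T p X f s q P Y S \<Gamma> \<sigma>)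
  let ?V = "vars_state st0 \<union> snd ` N"
  obtain Y' where Y': "HV Y' \<notin> ?V" "st' = ({AUP (HV Y') s q} \<union> P, S, \<Gamma>,
      comp_subst \<sigma> (single (HV X) [App f [Susp 1 (HV Y')]]))"
    using assms(2) Dec_T by (auto elim!: vnau_labelE dest: insert_ident)
  obtain \<rho> where \<rho>: "\<forall>\<chi>. is_hvar (\<rho> \<langle>$\<rangle> \<chi>) = is_hvar \<chi>" "\<forall>\<chi>\<in>?V. \<rho> \<langle>$\<rangle> \<chi> = \<chi>"
    "\<rho> \<langle>$\<rangle> (HV Y) = HV Y'"
    using renaming_one_exists[of "HV Y" ?V "HV Y'"] Dec_T Y' by auto
  \<comment> \<open>Both hedges occur in the decomposed AUP, so all their variables are old.\<close>
  have "map (rename \<rho>) s = s" "map (rename \<rho>) q = q"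
    using \<rho>(2) unfolding Dec_T by (auto simp: vars_hedge_def intro!: map_idI rename_fixed)
  then have "st' = rename_state \<rho> st"
    using \<rho>(2,3) unfolding Y' Dec_T
    by (simp add: rename_comp_subst_single rename_aups_fixed rename_fctx_fixed)
  with \<rho> show ?thesis by (intro variantI)
next
  case (Dec_H p X s1 s2 q1 q2 P Y1 S \<Gamma> \<sigma> Y2)
  note outer = this
  let ?V = "vars_state st0 \<union> snd ` N"
  obtain Y1' Y2' where Y': "HV Y1' \<notin> ?V" "HV Y2' \<notin> ?V" "Y1' \<noteq> Y2'"
    "st' = ({AUP (HV Y1') s1 q1, AUP (HV Y2') s2 q2} \<union> P, S, \<Gamma>,
      comp_subst \<sigma> (single (HV X) [Susp 1 (HV Y1'), Susp 1 (HV Y2')]))"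
    using assms(2) unfolding Dec_H(1)
  proof cases
    case (Dec_H p' P' Y1' S' \<Gamma>' \<sigma>' Y2')
    \<comment> \<open>The four pieces in the label determine the decomposed AUP, so both steps
      remove the same element.\<close>
    have "P' = P"
      using Dec_H(1,3,4) outer(2,4,5) by (auto dest: insert_ident)
    then have "st' = ({AUP (HV Y1') s1 q1, AUP (HV Y2') s2 q2} \<union> P, S, \<Gamma>,
        comp_subst \<sigma> (single (HV X) [Susp 1 (HV Y1'), Susp 1 (HV Y2')]))"
      using Dec_H(1,2) outer(2) by simp
    with Dec_H show ?thesis
      by (intro that[of Y1' Y2']) simp_all
  qed
  obtain \<rho> where \<rho>: "\<forall>\<chi>. is_hvar (\<rho> \<langle>$\<rangle> \<chi>) = is_hvar \<chi>" "\<forall>\<chi>\<in>?V. \<rho> \<langle>$\<rangle> \<chi> = \<chi>"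
    "\<rho> \<langle>$\<rangle> (HV Y1) = HV Y1'" "\<rho> \<langle>$\<rangle> (HV Y2) = HV Y2'"
    using renaming_two_exists[of Y1 ?V Y1' Y2 Y2'] Dec_H Y' by auto
  have "map (rename \<rho>) s1 = s1" "map (rename \<rho>) s2 = s2"
    "map (rename \<rho>) q1 = q1" "map (rename \<rho>) q2 = q2"
    using \<rho>(2) unfolding Dec_H by (auto simp: vars_hedge_def intro!: map_idI rename_fixed)
  then have "st' = rename_state \<rho> st"
    using \<rho>(2-) unfolding Y' Dec_H
    by (simp add: rename_comp_subst_single rename_aups_fixed rename_fctx_fixed)
  with \<rho> show ?thesis by (intro variantI)
next
  case (Abs_T p X a t1 b t2 P c Y S \<Gamma> \<sigma>)
  let ?V = "vars_state st0 \<union> snd ` N"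
  obtain Y' where Y': "HV Y' \<notin> ?V"
    "st' = ({AUP (HV Y') [act \<langle>c \<leftrightarrow> a\<rangle> t1] [act \<langle>c \<leftrightarrow> b\<rangle> t2]} \<union> P, S, \<Gamma>,
      comp_subst \<sigma> (single (HV X) [Abs c [Susp 1 (HV Y')]]))"
    using assms(2) Abs_T by (auto elim!: vnau_labelE dest: insert_ident)
  obtain \<rho> where \<rho>: "\<forall>\<chi>. is_hvar (\<rho> \<langle>$\<rangle> \<chi>) = is_hvar \<chi>" "\<forall>\<chi>\<in>?V. \<rho> \<langle>$\<rangle> \<chi> = \<chi>"
    "\<rho> \<langle>$\<rangle> (HV Y) = HV Y'"
    using renaming_one_exists[of "HV Y" ?V "HV Y'"] Abs_T Y' by auto
  \<comment> \<open>The new AUP contains swapped copies of these bodies; \<open>rename_act\<close>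
    moves the renaming past the swappings.\<close>
  have "rename \<rho> t1 = t1" "rename \<rho> t2 = t2"
    using \<rho>(2) unfolding Abs_T by (auto simp: vars_hedge_def intro!: rename_fixed)
  then have "st' = rename_state \<rho> st"
    using \<rho>(2,3) unfolding Y' Abs_T
    by (simp add: rename_comp_subst_single rename_aups_fixed rename_fctx_fixed rename_act)
  with \<rho> show ?thesis by (intro variantI)
next
  case (Nar_T p X t1 t2 S x P \<Gamma> \<sigma>)
  let ?V = "vars_state st0 \<union> snd ` N"
  obtain x' where x': "IV x' \<notin> ?V"
    "st' = (P, {AUP (IV x') [t1] [t2]} \<union> S,
      subst_fctx (single (HV X) [Susp 1 (IV x')] :: 'a subst) \<Gamma>,
      comp_subst \<sigma> (single (HV X) [Susp 1 (IV x')]))"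
    using assms(2) Nar_T by (auto elim!: vnau_labelE dest: insert_ident)
  obtain \<rho> where \<rho>: "\<forall>\<chi>. is_hvar (\<rho> \<langle>$\<rangle> \<chi>) = is_hvar \<chi>" "\<forall>\<chi>\<in>?V. \<rho> \<langle>$\<rangle> \<chi> = \<chi>"
    "\<rho> \<langle>$\<rangle> (IV x) = IV x'"
    using renaming_one_exists[of "IV x" ?V "IV x'"] Nar_T x' by auto
  have "rename \<rho> t1 = t1" "rename \<rho> t2 = t2"
    using \<rho>(2) unfolding Nar_T by (auto simp: vars_hedge_def intro!: rename_fixed)
  then have "st' = rename_state \<rho> st"
    using \<rho>(2,3) assms(3) unfolding x' Nar_T
    by (simp add: rename_comp_subst_single rename_aups_fixed rename_subst_fctx_single)
  with \<rho> show ?thesis by (intro variantI)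
qed

section \<open>The measure decreases\<close>

lemma symbols_act [simp]: "symbols (act \<pi> t) = symbols t"
  by (induction t) (auto simp: comp_def intro!: arg_cong[where f = sum_list])

text \<open>The label of an AUP counts among its variables, so a new label yields a new element and
  no set absorbs it.\<close>

lemma new_aup_notin: "\<chi> \<notin> vars_state (P, S, \<Gamma>, \<sigma>) \<Longrightarrow> AUP \<chi> l r \<notin> P \<union> S"
  by force

text \<open>\<open>Dec_T\<close> and \<open>Abs_T\<close> lower the first component.
  \<open>Tri_T\<close>, \<open>Dec_H\<close>, \<open>Sol_T\<close> and \<open>Sol_H\<close> lower
  the second without raising the first. \<open>Tri_H\<close>, \<open>Mer\<close> and
  \<open>Nar_T\<close> lower the third, fourth and fifth and keep all earlier ones; for
  \<open>Nar_T\<close> the drop comes from the label.\<close>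

lemma vnau_decreases:
  assumes "vnau A N k (P0, S0, \<Gamma>0, \<sigma>0) st" "finite P0" "finite S0"
  shows "(\<mu> st, \<mu> (P0, S0, \<Gamma>0, \<sigma>0)) \<in> lex5"
  using assms(1)
proof cases
  case (Dec_T p X f s q P Y)
  then have "AUP (HV Y) s q \<notin> P"
    using new_aup_notin[of "HV Y" P0 S0 \<Gamma>0 \<sigma>0] by auto
  then show ?thesis
    using assms Dec_T by (simp add: lex5_def)
next
  case (Dec_H p X s1 s2 q1 q2 P Y1 Y2)
  then have new: "AUP (HV Y1) s1 q1 \<notin> P" "AUP (HV Y2) s2 q2 \<notin> P"
    using new_aup_notin[of "HV Y1" P0 S0 \<Gamma>0 \<sigma>0] new_aup_notin[of "HV Y2" P0 S0 \<Gamma>0 \<sigma>0]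
    by auto
  \<comment> \<open>Both halves of the split are nonempty, so the cross term of the square is
    positive.\<close>
  have "length (s1 @ q1) * length (s2 @ q2) > 0"
    using Dec_H by auto
  then have "(length (s1 @ q1))\<^sup>2 + (length (s2 @ q2))\<^sup>2 < (length (s1 @ q1) + length (s2 @ q2))\<^sup>2"
    unfolding power2_sum by linarith
  then have sq: "(length s1 + length q1)\<^sup>2 + (length s2 + length q2)\<^sup>2
      < (length s1 + length s2 + (length q1 + length q2))\<^sup>2"
    by (simp add: ac_simps)
  show ?thesis
    using assms Dec_H new sq by (simp add: lex5_def add.assoc)
next
  case (Abs_T p X a t1 b t2 P c Y)
  then have "AUP (HV Y) [act \<langle>c \<leftrightarrow> a\<rangle> t1] [act \<langle>c \<leftrightarrow> b\<rangle> t2] \<notin> P"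
    using new_aup_notin[of "HV Y" P0 S0 \<Gamma>0 \<sigma>0] by auto
  then show ?thesis
    using assms Abs_T by (simp add: lex5_def)
next
  case (Sol_H p X s q P)
  then show ?thesis
    \<comment> \<open>The AUP leaving \<open>P\<close> may contain symbols, so the first component
      drops or stays equal; the deletion keeps this a comparison of numbers.\<close>
    using assms by (auto simp: lex5_def simp del: sum_list_eq_0_iff)
next
  case (Nar_T p X t1 t2 S x)
  then have "AUP (IV x) [t1] [t2] \<notin> S"
    using new_aup_notin[of "IV x" P0 S0 \<Gamma>0 \<sigma>0] by auto
  then show ?thesis
    using assms Nar_T by (simp add: lex5_def)
qed (use assms in \<open>auto simp: lex5_def\<close>)

text \<open>New variables can be named in infinitely many ways, so finiteness is meant up to
  \<open>variant\<close>, with \<open>R\<close> a finite set of representatives.\<close>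

theorem theorem1:
  fixes A :: "atom set" and N :: fctx
    and P S :: "'f::countable aup set" and \<Gamma> :: fctx and \<sigma> :: "'f subst"
  assumes "finite A" and "finite N"
    and "is_state (P, S, \<Gamma>, \<sigma>)" and "finite P" and "finite S"
  shows "(\<exists>R. finite R \<and>
            (\<forall>(k, st)\<in>R. vnau A N k (P, S, \<Gamma>, \<sigma>) st) \<and>
            (\<forall>k st. vnau A N k (P, S, \<Gamma>, \<sigma>) st \<longrightarrow>
               (\<exists>st'. (k, st') \<in> R \<and> variant (vars_state (P, S, \<Gamma>, \<sigma>) \<union> snd ` N) st' st))) \<and>
         (\<forall>k st. vnau A N k (P, S, \<Gamma>, \<sigma>) st \<longrightarrow> (\<mu> st, \<mu> (P, S, \<Gamma>, \<sigma>)) \<in> lex5)"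
proof (intro conjI allI impI)
  let ?s = "(P, S, \<Gamma>, \<sigma>)"
  \<comment> \<open>The choice is arbitrary for labels without a successor, but \<open>R\<close>
    ranges only over labels that have one.\<close>
  define succ where "succ k = (SOME st. vnau A N k ?s st)" for k
  define R where "R = (\<lambda>k. (k, succ k)) ` {k. \<exists>st. vnau A N k ?s st}"
  have succ: "vnau A N k ?s (succ k)" if "vnau A N k ?s st" for k st
    unfolding succ_def using that by (rule someI)
  have "finite R"
    unfolding R_def using assms finite_labels by blast
  moreover have "\<forall>(k, st)\<in>R. vnau A N k ?s st"
    using succ by (auto simp: R_def)
  moreover have "\<exists>st'. (k, st') \<in> R \<and> variant (vars_state ?s \<union> snd ` N) st' st"
    if "vnau A N k ?s st" for k st
  proof (intro exI conjI)
    show "(k, succ k) \<in> R"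
      using that unfolding R_def by blast
    show "variant (vars_state ?s \<union> snd ` N) (succ k) st"
      using vnau_label_variant[OF succ[OF that] that] assms(3) by simp
  qed
  ultimately show "\<exists>R. finite R \<and> (\<forall>(k, st)\<in>R. vnau A N k ?s st) \<and>
      (\<forall>k st. vnau A N k ?s st \<longrightarrow>
        (\<exists>st'. (k, st') \<in> R \<and> variant (vars_state ?s \<union> snd ` N) st' st))"
    by blast
  show "(\<mu> st, \<mu> ?s) \<in> lex5" if "vnau A N k ?s st" for k st
    using vnau_decreases[OF that] assms by blast
qed

end
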